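(* Let $\Pi$ be a hereditary graph property. (1) If $\Pi$ admits an $(\varepsilon,\delta,N,s)$-removal lemma, then it admits the following ordered container statement: for every integer $n\ge\max\{N,s\}$ and every $n$-vertex graph $G=(V,E)$ that is $\varepsilon$-far from $\Pi$, there are maps $$f:\{U\subseteq V:G[U]\in\Pi\}\longrightarrow\bigcup_{j=0}^{s-1}V_{\neq}^{j},\qquad C:\operatorname{im}(f)\longrightarrow\binom{V}{\le(1-\delta/s)n},$$ such that every entry of $f(U)$ belongs to $U$ and $U\subseteq C(f(U))$ whenever $G[U]\in\Pi$. (2) Conversely, suppose that $\Pi$ admits an $(\varepsilon,\eta,N,q)$-ordered container lemma. Then, for every integer $t\ge q$ such that $$\sum_{j=0}^{q}t^j(1-\eta)^{t-j}<1,$$ the property $\Pi$ admits an $(\varepsilon,\delta_t,N,t)$-removal lemma, where $$\delta_t=1-\sum_{j=0}^{q}t^j(1-\eta)^{t-j}>0.$$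
   Context: A graph is a finite simple labelled graph (no loops, no multiple edges). A graph property is a family of graphs closed under isomorphism; it is hereditary if closed under taking induced subgraphs. Distance: for graphs $G,G'$ on the same $n$-element vertex set, $\mathrm{dist}(G,G')=|E(G)\triangle E(G')|/n^2$, and $G$ is $\varepsilon$-far from $\Pi$ if the minimum of $\mathrm{dist}(G,G')$ over $G'\in\Pi$ with $V(G')=V(G)$ exceeds $\varepsilon$ (the minimum over the empty set being $+\infty$). Removal lemma: for reals $\varepsilon,\delta>0$ and integers $N,s\ge1$, $\Pi$ admits an $(\varepsilon,\delta,N,s)$-removal lemma if for every integer $n\ge N$ and every $n$-vertex graph $G=(V,E)$ that is $\varepsilon$-far from $\Pi$, there are at least $\delta\binom ns$ sets $S\in\binom Vs$ with $G[S]\notin\Pi$. $V_{\neq}^{j}$ denotes the ordered $j$-tuples of distinct elements of $V$, and $\binom{V}{\le x}$ the subsets of $V$ of size at most $x$. Ordered container lemma: for $\varepsilon,\eta>0$ and integers $N,q\ge0$, $\Pi$ admits an $(\varepsilon,\eta,N,q)$-ordered container lemma (i.e. an ordered container statement with proximity parameter $\varepsilon$, shrinkage $\eta$, threshold $N$ and fingerprint bound $q$) if for every $n\ge N$ and every $n$-vertex graph $G=(V,E)$ that is $\varepsilon$-far from $\Pi$ there exist maps $f:\{U\subseteq V:G[U]\in\Pi\}\to\bigcup_{j=0}^{q}V_{\neq}^{j}$ and $C:\operatorname{im}(f)\to\binom{V}{\le(1-\eta)n}$ such that every entry of $f(U)$ belongs to $U$ and $U\subseteq C(f(U))$ whenever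 $G[U]\in\Pi$.
   Formalization: In part (2) it is additionally assumed that η ≤ 1 or that Π is nonempty; for the empty property with η > 1 the container lemma holds vacuously, while δ_t may exceed 1 (e.g. q = 0, t = 1), so the claim fails there. *)

theory Defs
  imports "HOL-Library.Ramsey" "HOL-Library.Extended_Real"
begin

text \<open>
  A graph is a pair of a vertex set and a set of two-element sets of vertices. The vertices are
  drawn from an arbitrary type; taking any infinite type gives all finite graphs up to isomorphism.
\<close>

type_synonym 'a graph = "'a set \<times> 'a set set"

abbreviation verts :: "'a graph \<Rightarrow> 'a set" where "verts \<equiv> fst"
abbreviation edges :: "'a graph \<Rightarrow> 'a set set" where "edges \<equiv> snd"

definition simple_graph :: "'a graph \<Rightarrow> bool" where
  "simple_graph G \<longleftrightarrow> finite (verts G) \<and> edges G \<subseteq> nsets (verts G) 2"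

definition graph_iso :: "'a graph \<Rightarrow> 'a graph \<Rightarrow> bool" where
  "graph_iso G H \<longleftrightarrow>
     (\<exists>\<phi>. bij_betw \<phi> (verts G) (verts H) \<and> edges H = (\<lambda>e. \<phi> ` e) ` edges G)"

definition induced :: "'a graph \<Rightarrow> 'a set \<Rightarrow> 'a graph" where
  "induced G U = (U, {e \<in> edges G. e \<subseteq> U})"

definition graph_property :: "'a graph set \<Rightarrow> bool" where
  "graph_property P \<longleftrightarrow>
     (\<forall>G\<in>P. simple_graph G) \<and>
     (\<forall>G H. G \<in> P \<and> simple_graph H \<and> graph_iso G H \<longrightarrow> H \<in> P)"

definition hereditary :: "'a graph set \<Rightarrow> bool" where
  "hereditary P \<longleftrightarrow> (\<forall>G\<in>P. \<forall>U. U \<subseteq> verts G \<longrightarrow> induced G U \<in> P)"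

definition graph_dist :: "'a graph \<Rightarrow> 'a graph \<Rightarrow> real" where
  "graph_dist G G' = real (card (sym_diff (edges G) (edges G'))) / real (card (verts G)) ^ 2"

text \<open>
  The infimum below ranges over finitely many graphs, hence is a minimum unless there are none,
  in which case it is \<open>\<infinity>\<close>. For the graph without vertices the distance is \<open>0 / 0 = 0\<close>.
\<close>

definition dist_to_property :: "'a graph \<Rightarrow> 'a graph set \<Rightarrow> ereal" where
  "dist_to_property G P = (INF G'\<in>{G' \<in> P. verts G' = verts G}. ereal (graph_dist G G'))"

definition is_far :: "real \<Rightarrow> 'a graph \<Rightarrow> 'a graph set \<Rightarrow> bool" where
  "is_far \<epsilon> G P \<longleftrightarrow> ereal \<epsilon> < dist_to_property G P"

text \<open>
  The threshold \<open>N\<close> may be \<open>0\<close> here, because thresholds of container lemmas may be \<open>0\<close> and are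
  passed on to removal lemmas.
\<close>

definition removal_lemma :: "'a graph set \<Rightarrow> real \<Rightarrow> real \<Rightarrow> nat \<Rightarrow> nat \<Rightarrow> bool" where
  "removal_lemma P \<epsilon> \<delta> N s \<longleftrightarrow>
     \<epsilon> > 0 \<and> \<delta> > 0 \<and> s \<ge> 1 \<and>
     (\<forall>n\<ge>N. \<forall>G. simple_graph G \<and> card (verts G) = n \<and> is_far \<epsilon> G P \<longrightarrow>
        real (card {S \<in> nsets (verts G) s. induced G S \<notin> P}) \<ge> \<delta> * real (n choose s))"

definition distinct_tuples :: "'a set \<Rightarrow> nat \<Rightarrow> 'a list set" where
  "distinct_tuples V j = {xs. length xs = j \<and> distinct xs \<and> set xs \<subseteq> V}"

definition subsets_upto :: "'a set \<Rightarrow> real \<Rightarrow> 'a set set" where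
  "subsets_upto V x = {W. W \<subseteq> V \<and> real (card W) \<le> x}"

definition good_sets :: "'a graph \<Rightarrow> 'a graph set \<Rightarrow> 'a set set" where
  "good_sets G P = {U. U \<subseteq> verts G \<and> induced G U \<in> P}"

text \<open>
  For \<open>\<eta> > 1\<close> and \<open>n > 0\<close> there are no sets of size at most \<open>(1 - \<eta>) * n\<close>. The container lemma
  is then satisfied only if far graphs have no good sets at all; in particular the empty property
  satisfies it for every \<open>\<eta> > 0\<close>, so that the converse implication fails for the empty property
  and \<open>\<eta> > 1\<close>.
\<close>

definition ordered_container_lemma ::
    "'a graph set \<Rightarrow> real \<Rightarrow> real \<Rightarrow> nat \<Rightarrow> nat \<Rightarrow> bool" where
  "ordered_container_lemma P \<epsilon> \<eta> N q \<longleftrightarrow>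
     \<epsilon> > 0 \<and> \<eta> > 0 \<and>
     (\<forall>n\<ge>N. \<forall>G. simple_graph G \<and> card (verts G) = n \<and> is_far \<epsilon> G P \<longrightarrow>
        (\<exists>f C. f \<in> good_sets G P \<rightarrow> (\<Union>j\<in>{0..q}. distinct_tuples (verts G) j) \<and>
               C \<in> f ` good_sets G P \<rightarrow> subsets_upto (verts G) ((1 - \<eta>) * real n) \<and>
               (\<forall>U\<in>good_sets G P. set (f U) \<subseteq> U \<and> U \<subseteq> C (f U))))"

end

theory Submission
  imports Defs
begin

text \<open>
  \<^bold>\<open>From removal to containers.\<close> In a far graph, the \<open>s\<close>-sets inducing a graph outside the
  property form a dense \<open>s\<close>-uniform hypergraph \<open>H\<close>, and by heredity every good set \<open>U\<close> is
  independent in it. So the first half is a container lemma for dense uniform hypergraphs,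
  \<open>hypergraph_containers\<close>. Its algorithm queries a vertex \<open>v\<close> of large degree.
  If \<open>v \<in> U\<close>, then \<open>v\<close> is recorded in the fingerprint and \<open>U - {v}\<close> is independent in the link of
  \<open>v\<close>, whose uniformity is smaller by one; if \<open>v \<notin> U\<close>, then \<open>v\<close> is excluded from the container and
  deleted from the hypergraph. The density is measured by a real \<open>y\<close> with
  \<open>|H| \<ge> y (n - 1 choose s - 1)\<close>. This is the right normalisation: passing to the link of some
  vertex, for instance of one of maximum degree, does not decrease \<open>y\<close> (because \<open>s / n \<ge> (s - 1) / (n - 1)\<close> for \<open>n \<ge> s\<close>), while
  deleting a vertex costs at most \<open>1\<close> and pays for it by one excluded vertex. Hence at
  least \<open>y\<close> vertices are excluded in the end, and initially \<open>y = \<delta> n / s\<close>. At uniformity \<open>1\<close> all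
  edges are excluded vertices and no further query is needed, so that at most \<open>s - 1\<close> vertices
  are recorded.

  \<^bold>\<open>From containers to removal.\<close> A good \<open>t\<close>-set with fingerprint \<open>xs\<close> of length \<open>j\<close> lies between
  the entries of \<open>xs\<close> and the container of \<open>xs\<close>. There are \<open>n (n - 1) \<dots> (n - j + 1)\<close> tuples \<open>xs\<close>,
  and each leaves at most \<open>((1 - \<eta>) n - j choose t - j) \<le> (1 - \<eta>)\<^bsup>t-j\<^esup> (n - j choose t - j)\<close> sets.
  The product is at most \<open>t\<^bsup>j\<^esup> (1 - \<eta>)\<^bsup>t-j\<^esup> (n choose t)\<close>, since a \<open>t\<close>-set has at most \<open>t\<^bsup>j\<^esup>\<close> tuples of
  length \<open>j\<close>. Summing over \<open>j\<close> bounds the number of good \<open>t\<close>-sets (\<open>card_sets_with_fingerprints\<close>).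
\<close>

section \<open>Containers for dense uniform hypergraphs\<close>

text \<open>
  The degrees sum up to \<open>(k + 2) |H|\<close>, and a vertex whose degree is at least the average passes on
  the density to its link in the normalisation of \<open>hypergraph_containers\<close>: from \<open>y (m choose k + 1)\<close> edges of size \<open>k + 2\<close> on at
  most \<open>m + 1\<close> vertices one gets \<open>y (m - 1 choose k)\<close> edges in the link.
\<close>

lemma exists_vertex_with_dense_link:
  fixes y :: real
  assumes "finite V" and H: "H \<subseteq> nsets V (Suc (Suc k))" and V: "card V \<le> Suc m"
    and km: "Suc k \<le> m" and y: "y > 0" and dense: "y * real (m choose Suc k) \<le> real (card H)"
  shows "\<exists>v\<in>V. y * real ((m - 1) choose k) \<le> real (card {e\<in>H. v \<in> e})"
proof (rule ccontr)
  assume "\<not> ?thesis"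
  then have less: "real (card {e\<in>H. v \<in> e}) < y * real ((m - 1) choose k)" if "v \<in> V" for v
    using that by force
  have "finite H"
    using finite_subset[OF H] finite_imp_finite_nsets[OF \<open>finite V\<close>] by blast
  have "card {v\<in>V. v \<in> e} = Suc (Suc k)" if "e \<in> H" for e
  proof -
    have "{v\<in>V. v \<in> e} = e" "card e = Suc (Suc k)" using H that by (auto simp: nsets_def)
    then show ?thesis by simp
  qed
  then have sum: "(\<Sum>v\<in>V. card {e\<in>H. v \<in> e}) = Suc (Suc k) * card H"
    using \<open>finite V\<close> \<open>finite H\<close> by (intro sum_multicount) auto
  have pos: "0 < m choose Suc k" using km by simp
  have Hpos: "0 < card H" using dense y pos
    by (smt (verit) mult_pos_pos of_nat_0_less_iff)
  then have "V \<noteq> {}" using sum by auto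
  define b where "b = y * real ((m - 1) choose k)"
  have b: "b > 0" using y km by (simp add: b_def)
  have "real (Suc (Suc k) * card H) = (\<Sum>v\<in>V. real (card {e\<in>H. v \<in> e}))"
    using sum by (metis of_nat_sum)
  also have "\<dots> < (\<Sum>v\<in>V. b)"
    using \<open>finite V\<close> \<open>V \<noteq> {}\<close> less by (intro sum_strict_mono) (auto simp: b_def)
  also have "\<dots> \<le> real (Suc m) * b"
    using V b by (simp add: mult_right_mono del: of_nat_Suc)
  finally have 1: "real (Suc (Suc k)) * real (card H) < real (Suc m) * b"
    by (simp only: of_nat_mult)
  have "Suc k * (m choose Suc k) = m * ((m - 1) choose k)"
    by (rule binomial_absorption)
  then have abs: "real (Suc k) * (y * real (m choose Suc k)) = real m * b"
    unfolding b_def by (metis mult.left_commute of_nat_mult)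
  have "real (Suc (Suc k)) * (real m * b)
      = real (Suc k) * (real (Suc (Suc k)) * (y * real (m choose Suc k)))"
    unfolding abs[symmetric] by (simp add: algebra_simps)
  also have "\<dots> \<le> real (Suc k) * (real (Suc (Suc k)) * real (card H))"
    using dense by (intro mult_left_mono) auto
  also have "\<dots> < real (Suc k) * (real (Suc m) * b)"
    using 1 by (intro mult_strict_left_mono) auto
  finally have "(real (Suc (Suc k)) * real m) * b < (real (Suc k) * real (Suc m)) * b"
    by (simp only: mult.assoc)
  then have "real (Suc (Suc k)) * real m < real (Suc k) * real (Suc m)"
    using b by (meson mult_less_cancel_right_pos)
  then have "Suc (Suc k) * m < Suc k * Suc m" by (metis of_nat_less_iff of_nat_mult)
  then show False using km by simp
qed

lemma card_degree_le:
  assumes "finite V" "H \<subseteq> nsets V (Suc k)" "v \<in> V"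
  shows "card {e\<in>H. v \<in> e} \<le> (card V - 1) choose k"
proof -
  have "inj_on (\<lambda>e. e - {v}) {e\<in>H. v \<in> e}" by (auto simp: inj_on_def)
  moreover have "(\<lambda>e. e - {v}) ` {e\<in>H. v \<in> e} \<subseteq> nsets (V - {v}) k"
    using assms by (auto simp: nsets_def)
  ultimately have "card {e\<in>H. v \<in> e} \<le> card (nsets (V - {v}) k)"
    using assms by (intro card_inj_on_le) (auto intro: finite_imp_finite_nsets)
  then show ?thesis using assms by simp
qed

text \<open>
  The parameter \<open>m + 1\<close> only bounds the number of vertices, so that it can stay fixed when a vertex
  is deleted. Both branches of the query act on \<open>V - {v}\<close>, hence the induction on the number of
  vertices with all other parameters arbitrary.
\<close>

lemma hypergraph_containers:
  fixes y :: real
  assumes "finite V" "H \<subseteq> nsets V (Suc k)" "card V \<le> Suc m" "k \<le> m"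
    and "y * real (m choose k) \<le> real (card H)"
  shows "\<exists>f C. \<forall>U. U \<subseteq> V \<and> (\<forall>e\<in>H. \<not> e \<subseteq> U) \<longrightarrow>
     length (f U) \<le> k \<and> distinct (f U) \<and> set (f U) \<subseteq> U \<and>
     U \<subseteq> C (f U) \<and> C (f U) \<subseteq> V \<and> real (card (C (f U))) \<le> real (card V) - y"
  using assms
proof (induction "card V" arbitrary: V H k m y rule: less_induct)
  case less
  have finH: "finite H"
    using finite_subset[OF less.prems(2)] finite_imp_finite_nsets less.prems(1) by blast
  consider "y \<le> 0" | "y > 0" "k = 0" | k' where "y > 0" "k = Suc k'"
    by (cases k) force+
  then show ?case
  proof cases
    case 1
    then show ?thesis
      by (intro exI[of _ "\<lambda>_. []"] exI[of _ "\<lambda>_. V"]) auto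
  next
    case 2
    \<comment> \<open>The edges are singletons: the container excludes all of them.\<close>
    let ?B = "{v. {v} \<in> H}"
    have H: "H = (\<lambda>v. {v}) ` ?B"
      using less.prems(2) 2 by (auto simp: nsets_def card_1_singleton_iff)
    have B: "?B \<subseteq> V" using less.prems(2) by (auto simp: nsets_def)
    have "card H = card ?B" by (subst H) (simp add: card_image)
    then have "real (card (V - ?B)) \<le> real (card V) - y"
      using less.prems(1,5) 2 B card_mono[OF less.prems(1) B]
      by (simp add: card_Diff_subset finite_subset of_nat_diff)
    then show ?thesis
      by (intro exI[of _ "\<lambda>_. []"] exI[of _ "\<lambda>_. V - ?B"]) auto
  next
    case 3
    obtain v where v: "v \<in> V"
      and deg: "y * real ((m - 1) choose k') \<le> real (card {e\<in>H. v \<in> e})"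
      using exists_vertex_with_dense_link[of V H k' m y] less.prems 3 by auto
    define W where "W = V - {v}"
    have W: "card W < card V" "finite W" "Suc (card W) = card V"
      using v less.prems(1) card_Suc_Diff1[of V v] unfolding W_def
      by (simp_all only: card_Diff1_less finite_Diff)
    define L where "L = (\<lambda>e. e - {v}) ` {e\<in>H. v \<in> e}"
    define D where "D = {e\<in>H. v \<notin> e}"
    have cardL: "card L = card {e\<in>H. v \<in> e}"
      unfolding L_def by (intro card_image) (auto simp: inj_on_def)
    have L: "L \<subseteq> nsets W (Suc k')"
      using less.prems(2) 3 by (auto simp: L_def W_def nsets_def)
    have D: "D \<subseteq> nsets W (Suc k)"
      using less.prems(2) by (auto simp: D_def W_def nsets_def)
    have "card {e\<in>H. v \<in> e} + card D = card H"
      using finH by (subst card_Un_disjoint[symmetric]) (auto simp: D_def intro: arg_cong[of _ _ card])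
    moreover have "card {e\<in>H. v \<in> e} \<le> m choose k"
      by (rule order_trans[OF card_degree_le[OF less.prems(1,2) v] binomial_right_mono])
        (use less.prems(3) in linarith)
    ultimately have denseD: "(y - 1) * real (m choose k) \<le> real (card D)"
      using less.prems(5) by (simp add: algebra_simps flip: of_nat_add)
    have mW: "card W \<le> Suc m" "card W \<le> Suc (m - 1)" "k' \<le> m - 1"
      using W(3) less.prems(3,4) 3(2) by linarith+
    have denseL: "y * real ((m - 1) choose k') \<le> real (card L)" using deg cardL by simp
    obtain f0 C0 where fC0: "\<forall>U. U \<subseteq> W \<and> (\<forall>e\<in>D. \<not> e \<subseteq> U) \<longrightarrow>
        length (f0 U) \<le> k \<and> distinct (f0 U) \<and> set (f0 U) \<subseteq> U \<and>
        U \<subseteq> C0 (f0 U) \<and> C0 (f0 U) \<subseteq> W \<and> real (card (C0 (f0 U))) \<le> real (card W) - (y - 1)"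
      using less.hyps[OF W(1,2) D mW(1) less.prems(4) denseD] by (elim exE) (rule that)
    note 0 = fC0[THEN spec, THEN mp, OF conjI]
    obtain f1 C1 where fC1: "\<forall>U. U \<subseteq> W \<and> (\<forall>e\<in>L. \<not> e \<subseteq> U) \<longrightarrow>
        length (f1 U) \<le> k' \<and> distinct (f1 U) \<and> set (f1 U) \<subseteq> U \<and>
        U \<subseteq> C1 (f1 U) \<and> C1 (f1 U) \<subseteq> W \<and> real (card (C1 (f1 U))) \<le> real (card W) - y"
      using less.hyps[OF W(1,2) L mW(2,3) denseL] by (elim exE) (rule that)
    note 1 = fC1[THEN spec, THEN mp, OF conjI]
    \<comment> \<open>The container function can tell the two branches apart: \<open>v\<close> is the first entry of the
      fingerprint if \<open>v \<in> U\<close>, and no entry otherwise.\<close>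
    define f where "f U = (if v \<in> U then v # f1 (U - {v}) else f0 U)" for U
    define C where "C xs = (if xs \<noteq> [] \<and> hd xs = v then insert v (C1 (tl xs)) else C0 xs)" for xs
    have "length (f U) \<le> k \<and> distinct (f U) \<and> set (f U) \<subseteq> U \<and>
        U \<subseteq> C (f U) \<and> C (f U) \<subseteq> V \<and> real (card (C (f U))) \<le> real (card V) - y"
      if U: "U \<subseteq> V" and ind: "\<forall>e\<in>H. \<not> e \<subseteq> U" for U
    proof (cases "v \<in> U")
      case True
      have "\<forall>e\<in>L. \<not> e \<subseteq> U - {v}" using ind True by (auto simp: L_def)
      moreover have "U - {v} \<subseteq> W" using U by (auto simp: W_def)
      ultimately have *: "length (f1 (U - {v})) \<le> k'" "distinct (f1 (U - {v}))"
        "set (f1 (U - {v})) \<subseteq> U - {v}" "U - {v} \<subseteq> C1 (f1 (U - {v}))" "C1 (f1 (U - {v})) \<subseteq> W"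
        "real (card (C1 (f1 (U - {v})))) \<le> real (card W) - y"
        using 1[of "U - {v}"] by simp_all
      have "card (C (f U)) \<le> Suc (card (C1 (f1 (U - {v}))))"
        using True by (simp add: C_def f_def card_insert_le_m1)
      moreover have "real (card V) = real (card W) + 1" using W(3) by linarith
      ultimately have "real (card (C (f U))) \<le> real (card V) - y"
        using *(6) by linarith
      then show ?thesis using True *(1-5) 3 v by (auto simp: f_def C_def W_def)
    next
      case False
      have "\<forall>e\<in>D. \<not> e \<subseteq> U" using ind by (auto simp: D_def)
      moreover have "U \<subseteq> W" using U False by (auto simp: W_def)
      ultimately have *: "length (f0 U) \<le> k" "distinct (f0 U)"
        "set (f0 U) \<subseteq> U" "U \<subseteq> C0 (f0 U)" "C0 (f0 U) \<subseteq> W"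
        "real (card (C0 (f0 U))) \<le> real (card W) - (y - 1)"
        using 0[of U] by simp_all
      have "f0 U \<noteq> [] \<Longrightarrow> hd (f0 U) \<noteq> v" using *(3) False hd_in_set by fastforce
      then have [simp]: "f U = f0 U" "C (f0 U) = C0 (f0 U)"
        using False by (auto simp: f_def C_def)
      have "real (card V) = real (card W) + 1" using W(3) by linarith
      then show ?thesis using * by (auto simp: W_def)
    qed
    then show ?thesis by (intro exI[of _ f] exI[of _ C]) simp
  qed
qed

section \<open>Counting sets with short fingerprints and small containers\<close>

text \<open>
  The ratio of the two binomial coefficients is the product of \<open>(c - j - i) / (n - j - i)\<close> over
  \<open>i < r\<close>. As \<open>c \<le> n\<close>, each factor is at most \<open>c / n \<le> x\<close>.
\<close>

lemma binomial_le_power_mult_binomial: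
  fixes x :: real
  assumes "real c \<le> x * real n" "x \<le> 1" "n > 0"
  shows "real ((c - j) choose r) \<le> x ^ r * real ((n - j) choose r)"
proof (induction r arbitrary: j)
  case (Suc r)
  have x: "0 \<le> x" using assms by (smt (verit) mult_neg_pos of_nat_0_le_iff of_nat_0_less_iff)
  show ?case
  proof (cases "j < c")
    case True
    have "x * real n \<le> real n" using assms by (simp add: mult_left_le_one_le x)
    then have "c \<le> n" using assms by linarith
    have "x * real j \<le> real j" using assms x by (simp add: mult_left_le_one_le)
    then have "real (c - j) \<le> x * real (n - j)"
      using assms True \<open>c \<le> n\<close> by (simp add: of_nat_diff algebra_simps)
    have "real (Suc r) * real ((c - j) choose Suc r) = real (c - j) * real ((c - Suc j) choose r)"
      using binomial_absorption[of r "c - j"] by (metis of_nat_mult diff_diff_left plus_1_eq_Suc add.commute)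
    also have "\<dots> \<le> (x * real (n - j)) * (x ^ r * real ((n - Suc j) choose r))"
      using \<open>real (c - j) \<le> x * real (n - j)\<close> Suc.IH[of "Suc j"] x by (intro mult_mono) auto
    also have "\<dots> = x ^ Suc r * (real (n - j) * real ((n - Suc j) choose r))"
      by simp
    also have "real (n - j) * real ((n - Suc j) choose r)
        = real (Suc r) * real ((n - j) choose Suc r)"
      using binomial_absorption[of r "n - j"] by (metis of_nat_mult diff_diff_left plus_1_eq_Suc add.commute)
    finally have "real (Suc r) * real ((c - j) choose Suc r)
        \<le> real (Suc r) * (x ^ Suc r * real ((n - j) choose Suc r))"
      by (simp only: ac_simps)
    then show ?thesis by (simp only: mult_le_cancel_left_pos of_nat_0_less_iff zero_less_Suc)
  next
    case False
    then show ?thesis using x by simp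
  qed
qed simp

text \<open>
  The left-hand side counts the pairs of a \<open>t\<close>-set in an \<open>n\<close>-set and a \<open>j\<close>-tuple of distinct elements
  of the \<open>t\<close>-set, choosing the tuple first. Choosing the \<open>t\<close>-set first leaves at most \<open>t\<^sup>j\<close> tuples.
\<close>

lemma falling_factorial_mult_binomial_le:
  assumes "j \<le> t" "t \<le> n"
  shows "(\<Prod>{n - j + 1..n}) * ((n - j) choose (t - j)) \<le> t ^ j * (n choose t)"
proof -
  have "(\<Prod>{n - j + 1..n}) = fact j * (n choose j)"
  proof -
    have "fact (n - j) * (fact j * (n choose j)) = (fact n :: nat)"
      using binomial_fact_lemma[of j n] assms by (simp add: mult_ac)
    then have "fact j * (n choose j) = fact n div fact (n - j)"
      by (metis fact_nonzero nonzero_mult_div_cancel_left)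
    then show ?thesis using fact_div_fact[of "n - j" n] by simp
  qed
  then have "(\<Prod>{n - j + 1..n}) * ((n - j) choose (t - j)) = fact j * (t choose j) * (n choose t)"
    using choose_mult[OF assms] by (simp add: mult.assoc mult.commute mult.left_commute)
  moreover have "fact j * (t choose j) \<le> t ^ j"
    using binomial_fact_pow[of t j] by (simp add: mult.commute)
  ultimately show ?thesis by simp
qed

lemma card_nsets_between_le:
  assumes "finite K" "T \<subseteq> K" "card T \<le> t"
  shows "card {S \<in> nsets K t. T \<subseteq> S} \<le> (card K - card T) choose (t - card T)"
proof -
  have "finite T" using assms finite_subset by blast
  have "inj_on (\<lambda>S. S - T) {S \<in> nsets K t. T \<subseteq> S}" by (auto simp: inj_on_def)
  moreover have "(\<lambda>S. S - T) ` {S \<in> nsets K t. T \<subseteq> S} \<subseteq> nsets (K - T) (t - card T)"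
    using \<open>finite T\<close> by (auto simp: nsets_def card_Diff_subset)
  ultimately have "card {S \<in> nsets K t. T \<subseteq> S} \<le> card (nsets (K - T) (t - card T))"
    using assms by (intro card_inj_on_le) (auto intro: finite_imp_finite_nsets)
  then show ?thesis using assms \<open>finite T\<close> by (simp add: card_Diff_subset)
qed

lemma finite_distinct_tuples: "finite V \<Longrightarrow> finite (distinct_tuples V j)"
  unfolding distinct_tuples_def
  by (rule finite_subset[OF _ finite_lists_length_eq[of V j]]) auto

lemma card_distinct_tuples:
  assumes "finite V" "j \<le> card V"
  shows "card (distinct_tuples V j) = \<Prod>{card V - j + 1..card V}"
  using card_lists_distinct_length_eq[OF assms] by (simp add: distinct_tuples_def)

text \<open>
  Union bound over all fingerprints: a set in \<open>A\<close> with fingerprint \<open>xs\<close> lies between \<open>set xs\<close> and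
  \<open>C xs\<close>.
\<close>

lemma card_sets_with_fingerprints:
  fixes x :: real
  assumes V: "finite V" "card V = n" "n > 0" and x: "0 \<le> x" "x \<le> 1" and qt: "q \<le> t" "t \<le> n"
    and A: "A \<subseteq> nsets V t"
    and f: "\<And>S. S \<in> A \<Longrightarrow> f S \<in> (\<Union>j\<in>{0..q}. distinct_tuples V j) \<and> set (f S) \<subseteq> S"
    and C: "\<And>S. S \<in> A \<Longrightarrow> S \<subseteq> C (f S) \<and> C (f S) \<in> subsets_upto V (x * real n)"
  shows "real (card A) \<le> (\<Sum>j=0..q. real t ^ j * x ^ (t - j)) * real (n choose t)"
proof -
  define I where "I j = distinct_tuples V j \<inter> f ` A" for j
  define B where "B xs = {S \<in> nsets (C xs) t. set xs \<subseteq> S}" for xs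
  have finI: "finite (I j)" for j using finite_distinct_tuples[OF V(1)] by (simp add: I_def)
  have finC: "finite (C xs)" if "xs \<in> I j" for xs j
    using that C V(1) by (auto simp: I_def subsets_upto_def intro: finite_subset)
  have finB: "finite (B xs)" if "xs \<in> I j" for xs j
    using finite_imp_finite_nsets[OF finC[OF that]] by (simp add: B_def)
  have B: "real (card (B xs)) \<le> x ^ (t - j) * real ((n - j) choose (t - j))"
    if xs: "xs \<in> I j" and "j \<le> q" for xs j
  proof -
    obtain S where S: "S \<in> A" "xs = f S" using xs by (auto simp: I_def)
    have card_xs: "card (set xs) = j" using xs by (auto simp: I_def distinct_tuples_def distinct_card)
    have "set xs \<subseteq> C xs" using f[OF S(1)] C[OF S(1)] S(2) by blast
    then have "card (B xs) \<le> (card (C xs) - j) choose (t - j)"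
      using card_nsets_between_le[OF finC[OF xs], of "set xs" t] \<open>j \<le> q\<close> qt card_xs
      by (simp add: B_def)
    also have "real \<dots> \<le> x ^ (t - j) * real ((n - j) choose (t - j))"
      using C[OF S(1)] S(2) x V(3)
      by (intro binomial_le_power_mult_binomial) (auto simp: subsets_upto_def)
    finally show ?thesis by simp
  qed
  have "A \<subseteq> (\<Union>j\<in>{0..q}. \<Union>xs\<in>I j. B xs)"
  proof
    fix S assume "S \<in> A"
    then obtain j where "j \<in> {0..q}" "f S \<in> I j" using f unfolding I_def by blast
    moreover have "S \<in> B (f S)" using f[OF \<open>S \<in> A\<close>] C[OF \<open>S \<in> A\<close>] A \<open>S \<in> A\<close>
      by (auto simp: B_def nsets_def)
    ultimately show "S \<in> (\<Union>j\<in>{0..q}. \<Union>xs\<in>I j. B xs)" by blast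
  qed
  then have "card A \<le> card (\<Union>j\<in>{0..q}. \<Union>xs\<in>I j. B xs)"
    using finI finB by (intro card_mono) auto
  also have "\<dots> \<le> (\<Sum>j=0..q. card (\<Union>xs\<in>I j. B xs))"
    by (intro card_UN_le) simp
  also have "\<dots> \<le> (\<Sum>j=0..q. \<Sum>xs\<in>I j. card (B xs))"
    using finI by (intro sum_mono card_UN_le)
  finally have "real (card A) \<le> (\<Sum>j=0..q. \<Sum>xs\<in>I j. real (card (B xs)))"
    by (metis (mono_tags, lifting) of_nat_le_iff of_nat_sum sum.cong)
  also have "\<dots> \<le> (\<Sum>j=0..q. (real t ^ j * x ^ (t - j)) * real (n choose t))"
  proof (rule sum_mono)
    fix j assume "j \<in> {0..q}"
    then have j: "j \<le> q" "j \<le> t" "j \<le> n" using qt by auto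
    have "card (I j) \<le> card (distinct_tuples V j)"
      using finite_distinct_tuples[OF V(1)] by (intro card_mono) (auto simp: I_def)
    also have "\<dots> = \<Prod>{n - j + 1..n}" using card_distinct_tuples[of V j] V j by simp
    finally have cardI: "card (I j) \<le> \<Prod>{n - j + 1..n}" .
    have "(\<Sum>xs\<in>I j. real (card (B xs)))
        \<le> real (card (I j)) * (x ^ (t - j) * real ((n - j) choose (t - j)))"
      using B j by (intro sum_bounded_above) auto
    also have "\<dots> \<le> real (\<Prod>{n - j + 1..n}) * (x ^ (t - j) * real ((n - j) choose (t - j)))"
      using cardI x by (intro mult_right_mono of_nat_mono) auto
    also have "\<dots> = x ^ (t - j) * real (\<Prod>{n - j + 1..n} * ((n - j) choose (t - j)))"
      by simp
    also have "\<dots> \<le> x ^ (t - j) * real (t ^ j * (n choose t))"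
      using falling_factorial_mult_binomial_le[OF j(2) qt(2)] x
      by (intro mult_left_mono of_nat_mono) auto
    finally show "(\<Sum>xs\<in>I j. real (card (B xs)))
        \<le> (real t ^ j * x ^ (t - j)) * real (n choose t)"
      by (simp add: mult_ac)
  qed
  finally show ?thesis by (simp add: sum_distrib_right)
qed

section \<open>Removal lemmas and ordered container lemmas\<close>

lemma induced_induced: "S \<subseteq> U \<Longrightarrow> induced (induced G U) S = induced G S"
  by (auto simp: induced_def)

lemma good_sets_subset:
  assumes "hereditary P" "U \<in> good_sets G P" "S \<subseteq> U"
  shows "induced G S \<in> P"
proof -
  have "induced G U \<in> P" "S \<subseteq> verts (induced G U)"
    using assms by (auto simp: good_sets_def induced_def)
  then have "induced (induced G U) S \<in> P" using assms(1) by (auto simp: hereditary_def)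
  then show ?thesis using assms(3) by (simp add: induced_induced)
qed

lemma empty_in_good_sets:
  assumes "hereditary P" "P \<noteq> {}" "graph_property P" "simple_graph G"
  shows "{} \<in> good_sets G P"
proof -
  obtain H where H: "H \<in> P" using assms by blast
  have no_edge: "induced F {} = ({}, {})" if "simple_graph F" for F :: "'a graph"
    using that by (auto simp: induced_def simple_graph_def nsets_def)
  have "induced H {} \<in> P" using assms(1) H unfolding hereditary_def by blast
  moreover have "simple_graph H" using assms(3) H by (auto simp: graph_property_def)
  ultimately show ?thesis using no_edge assms(4) by (simp add: good_sets_def)
qed

lemma removal_imp_ordered_container:
  assumes her: "hereditary P" and rem: "removal_lemma P \<epsilon> \<delta> N s"
  shows "ordered_container_lemma P \<epsilon> (\<delta> / real s) (max N s) (s - 1)"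
proof -
  have pos: "\<epsilon> > 0" "\<delta> > 0" "s \<ge> 1" using rem by (auto simp: removal_lemma_def)
  have "\<exists>f C. f \<in> good_sets G P \<rightarrow> (\<Union>j\<in>{0..s - 1}. distinct_tuples (verts G) j) \<and>
          C \<in> f ` good_sets G P \<rightarrow> subsets_upto (verts G) ((1 - \<delta> / real s) * real n) \<and>
          (\<forall>U\<in>good_sets G P. set (f U) \<subseteq> U \<and> U \<subseteq> C (f U))"
    if n: "n \<ge> max N s" "card (verts G) = n" and G: "simple_graph G" "is_far \<epsilon> G P" for n G
  proof -
    define H where "H = {S \<in> nsets (verts G) s. induced G S \<notin> P}"
    have H: "real (card H) \<ge> \<delta> * real (n choose s)"
      using rem[unfolded removal_lemma_def, THEN conjunct2, THEN conjunct2, THEN conjunct2,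
          rule_format, of n G] n G
      unfolding H_def by linarith
    have "s * (n choose s) = n * ((n - 1) choose (s - 1))"
      using binomial_absorption[of "s - 1" n] pos(3) by simp
    then have "real s * real (n choose s) = real n * real ((n - 1) choose (s - 1))"
      by (metis of_nat_mult)
    then have "\<delta> * real n / real s * real ((n - 1) choose (s - 1)) = \<delta> * real (n choose s)"
      using pos(3) by (simp add: field_simps)
    then have dense: "\<delta> * real n / real s * real ((n - 1) choose (s - 1)) \<le> real (card H)"
      using H by simp
    have "finite (verts G)" "H \<subseteq> nsets (verts G) (Suc (s - 1))" "card (verts G) \<le> Suc (n - 1)"
      "s - 1 \<le> n - 1"
      using G n pos(3) by (auto simp: simple_graph_def H_def)
    from hypergraph_containers[OF this dense] obtain f C where
      "\<forall>U. U \<subseteq> verts G \<and> (\<forall>e\<in>H. \<not> e \<subseteq> U) \<longrightarrow>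
        length (f U) \<le> s - 1 \<and> distinct (f U) \<and> set (f U) \<subseteq> U \<and> U \<subseteq> C (f U) \<and>
        C (f U) \<subseteq> verts G \<and> real (card (C (f U))) \<le> real (card (verts G)) - \<delta> * real n / real s"
      by (elim exE) (rule that)
    note fC = this[THEN spec, THEN mp, OF conjI]
    have U: "U \<subseteq> verts G" "\<forall>e\<in>H. \<not> e \<subseteq> U" if "U \<in> good_sets G P" for U
      using that good_sets_subset[OF her that] by (auto simp: H_def good_sets_def)
    have size: "(1 - \<delta> / real s) * real n = real (card (verts G)) - \<delta> * real n / real s"
      using n by (simp add: algebra_simps)
    have "f U \<in> (\<Union>j\<in>{0..s - 1}. distinct_tuples (verts G) j)" if "U \<in> good_sets G P" for U
      using fC[OF U[OF that]] U(1)[OF that] by (auto simp: distinct_tuples_def)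
    moreover have "C (f U) \<in> subsets_upto (verts G) ((1 - \<delta> / real s) * real n)"
      if "U \<in> good_sets G P" for U
      using fC[OF U[OF that]] by (simp add: subsets_upto_def size)
    moreover have "set (f U) \<subseteq> U \<and> U \<subseteq> C (f U)" if "U \<in> good_sets G P" for U
      using fC[OF U[OF that]] by blast
    ultimately show ?thesis by (intro exI[of _ f] exI[of _ C]) blast
  qed
  then show ?thesis using pos by (simp add: ordered_container_lemma_def)
qed

text \<open>
  The good \<open>t\<close>-sets are counted by \<open>card_sets_with_fingerprints\<close> with \<open>x = 1 - \<eta>\<close>, which has to be
  nonnegative. For \<open>\<eta> > 1\<close> a container of a far graph on at least one vertex would have negative size, although
  the empty set is good if the property is nonempty; so there are no such graphs beyond the threshold.
\<close>

lemma ordered_container_imp_removal: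
  assumes gp: "graph_property P" and her: "hereditary P"
    and con: "ordered_container_lemma P \<epsilon> \<eta> N q" and \<eta>: "\<eta> \<le> 1 \<or> P \<noteq> {}"
    and qt: "q \<le> t" and less: "(\<Sum>j=0..q. real t ^ j * (1 - \<eta>) ^ (t - j)) < 1"
  shows "removal_lemma P \<epsilon> (1 - (\<Sum>j=0..q. real t ^ j * (1 - \<eta>) ^ (t - j))) N t"
proof -
  define \<sigma> where "\<sigma> = (\<Sum>j=0..q. real t ^ j * (1 - \<eta>) ^ (t - j))"
  have pos: "\<epsilon> > 0" "\<eta> > 0" using con by (auto simp: ordered_container_lemma_def)
  \<comment> \<open>For \<open>t = 0\<close> the sum is \<open>0 ^ 0 = 1\<close>.\<close>
  have t: "t \<ge> 1" using less qt by (cases t) auto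
  have "real (card {S \<in> nsets (verts G) t. induced G S \<notin> P}) \<ge> (1 - \<sigma>) * real (n choose t)"
    if n: "n \<ge> N" "card (verts G) = n" and G: "simple_graph G" "is_far \<epsilon> G P" for n G
  proof (cases "t \<le> n")
    case False
    then show ?thesis by (simp add: binomial_eq_0)
  next
    case True
    obtain f C where f: "f \<in> good_sets G P \<rightarrow> (\<Union>j\<in>{0..q}. distinct_tuples (verts G) j)"
      and C: "C \<in> f ` good_sets G P \<rightarrow> subsets_upto (verts G) ((1 - \<eta>) * real n)"
      and fC: "\<And>U. U \<in> good_sets G P \<Longrightarrow> set (f U) \<subseteq> U \<and> U \<subseteq> C (f U)"
      using con[unfolded ordered_container_lemma_def, THEN conjunct2, THEN conjunct2,
          rule_format, OF n(1), of G] n(2) G by blast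
    have "\<eta> \<le> 1"
    proof (rule ccontr)
      assume "\<not> \<eta> \<le> 1"
      then have "{} \<in> good_sets G P" using empty_in_good_sets[OF her _ gp G(1)] \<eta> by blast
      then have "real (card (C (f {}))) \<le> (1 - \<eta>) * real n"
        using C by (auto simp: subsets_upto_def)
      moreover have "(1 - \<eta>) * real n < 0"
        using \<open>\<not> \<eta> \<le> 1\<close> True t by (intro mult_neg_pos) auto
      ultimately show False by linarith
    qed
    define A where "A = {S \<in> nsets (verts G) t. induced G S \<in> P}"
    define B where "B = {S \<in> nsets (verts G) t. induced G S \<notin> P}"
    have V: "finite (verts G)" using G by (simp add: simple_graph_def)
    have fin: "finite A" "finite B"
      using finite_imp_finite_nsets[OF V] by (simp_all add: A_def B_def)
    have "A \<union> B = nsets (verts G) t" "A \<inter> B = {}" by (auto simp: A_def B_def)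
    then have "card A + card B = n choose t"
      using card_Un_disjoint[OF fin] n(2) by simp
    have A: "S \<in> good_sets G P" if "S \<in> A" for S
      using that by (auto simp: A_def good_sets_def nsets_def)
    have "real (card A) \<le> \<sigma> * real (n choose t)"
      unfolding \<sigma>_def
    proof (rule card_sets_with_fingerprints[OF V n(2)])
      show "A \<subseteq> nsets (verts G) t" by (auto simp: A_def)
      show "f S \<in> (\<Union>j\<in>{0..q}. distinct_tuples (verts G) j) \<and> set (f S) \<subseteq> S" if "S \<in> A" for S
        using f fC A[OF that] by blast
      show "S \<subseteq> C (f S) \<and> C (f S) \<in> subsets_upto (verts G) ((1 - \<eta>) * real n)" if "S \<in> A" for S
        using C fC A[OF that] by blast
    qed (use True t \<open>\<eta> \<le> 1\<close> pos qt in auto)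
    then have "(1 - \<sigma>) * real (n choose t) \<le> real (card B)"
      using \<open>card A + card B = n choose t\<close>[symmetric] by (simp add: algebra_simps)
    then show ?thesis by (simp add: B_def)
  qed
  then show ?thesis using pos t less by (simp add: removal_lemma_def \<sigma>_def)
qed

theorem theorem2p2:
  fixes P :: "'a graph set"
  assumes "graph_property P" and "hereditary P"
  shows
    "(\<forall>\<epsilon> \<delta> N s. removal_lemma P \<epsilon> \<delta> N s \<longrightarrow>
        ordered_container_lemma P \<epsilon> (\<delta> / real s) (max N s) (s - 1)) \<and>
     (\<forall>\<epsilon> \<eta> N q. ordered_container_lemma P \<epsilon> \<eta> N q \<and> (\<eta> \<le> 1 \<or> P \<noteq> {}) \<longrightarrow>
        (\<forall>t\<ge>q. (\<Sum>j=0..q. real t ^ j * (1 - \<eta>) ^ (t - j)) < 1 \<longrightarrow>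
           1 - (\<Sum>j=0..q. real t ^ j * (1 - \<eta>) ^ (t - j)) > 0 \<and>
           removal_lemma P \<epsilon> (1 - (\<Sum>j=0..q. real t ^ j * (1 - \<eta>) ^ (t - j))) N t))"
  using removal_imp_ordered_container[OF assms(2)] ordered_container_imp_removal[OF assms]
  by auto

end
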